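(* For all integers $a, b \ge 1$ with $a \le 27$, one has $e(E^a \oplus_1 E^b) \ge a + b + 1$; that is, the space $E^a \oplus_1 E^b$ contains an equilateral set of size $a+b+1$.
   Context: An equilateral set in a normed space $(X, \lVert\cdot\rVert)$ is a subset $S \subset X$ for which there is a fixed $\lambda > 0$ such that $\lVert x - y\rVert = \lambda$ for all distinct $x, y \in S$. For a finite-dimensional real normed space $X$, $e(X)$ denotes the maximum size of an equilateral set in $X$. $E^n$ denotes real $n$-dimensional Euclidean space, i.e. $\mathbb{R}^n$ with the Euclidean norm $\lVert\cdot\rVert_2$. $E^a \oplus_1 E^b$ denotes $\mathbb{R}^a \times \mathbb{R}^b$ equipped with the norm $\lVert (x,y)\rVert = \lVert x\rVert_2 + \lVert y\rVert_2$ for $x \in \mathbb{R}^a$, $y \in \mathbb{R}^b$. *)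

theory Defs
  imports "HOL-Analysis.Analysis"
begin

text \<open>The library's norm on a product type is the Euclidean combination of the norms of the
  components, so the \<open>\<ell>\<^sub>1\<close>-sum needs a type of its own.\<close>

datatype ('a, 'b) l1_sum (\<open>(_ \<oplus>\<^sub>1/ _)\<close> [21, 20] 20) =
  L1 (l1_fst: 'a) (l1_snd: 'b)

instantiation l1_sum :: (real_vector, real_vector) real_vector
begin

definition "0 = L1 0 0"
definition "x + y = L1 (l1_fst x + l1_fst y) (l1_snd x + l1_snd y)"
definition "- x = L1 (- l1_fst x) (- l1_snd x)"
definition "x - y = L1 (l1_fst x - l1_fst y) (l1_snd x - l1_snd y)"
definition "scaleR r x = L1 (scaleR r (l1_fst x)) (scaleR r (l1_snd x))"

instance
  by standard
    (simp_all add: zero_l1_sum_def plus_l1_sum_def uminus_l1_sum_def minus_l1_sum_def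
      scaleR_l1_sum_def algebra_simps)

end

instantiation l1_sum :: (real_normed_vector, real_normed_vector) real_normed_vector
begin

definition "norm (z :: 'a \<oplus>\<^sub>1 'b) = norm (l1_fst z) + norm (l1_snd z)"

definition "dist (x :: 'a \<oplus>\<^sub>1 'b) y = norm (x - y)"

definition "sgn (x :: 'a \<oplus>\<^sub>1 'b) = x /\<^sub>R norm x"

definition "(uniformity :: (('a \<oplus>\<^sub>1 'b) \<times> ('a \<oplus>\<^sub>1 'b)) filter) =
  (INF e\<in>{0<..}. principal {(x, y). dist x y < e})"

definition "open (U :: ('a \<oplus>\<^sub>1 'b) set) \<longleftrightarrow>
  (\<forall>x\<in>U. eventually (\<lambda>(x', y). x' = x \<longrightarrow> y \<in> U) uniformity)"

instance
proof
  fix x y :: "'a \<oplus>\<^sub>1 'b" and r :: real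
  show "norm x = 0 \<longleftrightarrow> x = 0"
    by (cases x) (simp add: norm_l1_sum_def zero_l1_sum_def add_nonneg_eq_0_iff)
  show "norm (x + y) \<le> norm x + norm y"
    using norm_triangle_ineq[of "l1_fst x" "l1_fst y"] norm_triangle_ineq[of "l1_snd x" "l1_snd y"]
    by (simp add: norm_l1_sum_def plus_l1_sum_def)
  show "norm (r *\<^sub>R x) = \<bar>r\<bar> * norm x"
    by (simp add: norm_l1_sum_def scaleR_l1_sum_def algebra_simps)
qed (rule dist_l1_sum_def sgn_l1_sum_def uniformity_l1_sum_def open_l1_sum_def)+

end

definition equilateral :: "'a::real_normed_vector set \<Rightarrow> bool"
  where "equilateral S \<longleftrightarrow> (\<exists>l>0. \<forall>x\<in>S. \<forall>y\<in>S. x \<noteq> y \<longrightarrow> norm (x - y) = l)"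

text \<open>Meaningful only for finite-dimensional spaces: there every equilateral set is finite and
  the cardinalities are bounded, so the maximum exists.\<close>

definition equilateral_number :: "'a::real_normed_vector itself \<Rightarrow> nat"
  where "equilateral_number _ = Max {card S | S :: 'a set. finite S \<and> equilateral S}"

end

theory Submission
  imports Defs
begin

text \<open>
  Exchanging the summands if necessary, let \<open>a \<le> b\<close>. The \<open>N = a + b + 1\<close> points are divided into
  \<open>a + 1\<close> clusters whose sizes are as equal as possible, so \<open>n\<close> or \<open>n + 1\<close>. The points of a cluster
  share their first component, and their second components form a regular simplex of side \<open>1\<close>
  centred at the origin. The simplices of distinct clusters lie in orthogonal subspaces; each
  cluster costs one dimension less than its size, so \<open>N - (a + 1) = b\<close> dimensions are enough
  (\<open>orthogonal_clusters\<close>).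

  The second components of points from clusters of sizes \<open>m\<close> and \<open>m'\<close> are at distance
  \<open>sqrt (((1 - 1 / m) + (1 - 1 / m')) / 2)\<close>, so the first components of these clusters have to be at
  the complementary distance. That prescribes three distances: \<open>\<alpha>\<close> between
  clusters of size \<open>n\<close>, \<open>\<beta>\<close> between clusters of size \<open>n + 1\<close>, and \<open>\<gamma>\<close> across. Two regular simplices
  of sides \<open>\<alpha>\<close> and \<open>\<beta>\<close> in orthogonal subspaces, moved apart in a further orthogonal direction,
  realise them as soon as \<open>\<gamma>\<close> is at least the distance without the translation
  (\<open>two_simplices\<close>), and any \<open>a + 1\<close> points fit into dimension \<open>a\<close>.

  It remains to compare \<open>\<gamma>\<close> with that distance (\<open>simplices_fit\<close>), and here the bound on \<open>a\<close>
  enters. With \<open>p\<close>, \<open>q\<close>, \<open>r\<close> the complements of \<open>\<alpha>\<close>, \<open>\<beta>\<close>, \<open>\<gamma>\<close> to \<open>1\<close>, the number \<open>r\<close> is the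
  quadratic mean of \<open>p\<close> and \<open>q\<close>, and the inequality reduces to
  \<open>4 * r - 2 * (p + q) \<le> (2 - p - q)\<^sup>2 / (a + 1)\<close>. The critical case is \<open>n = 2\<close>, where it holds up to
  \<open>a + 1 = 28\<close>. For \<open>n = 1\<close> it can fail for much smaller \<open>a\<close>, but \<open>a \<le> b\<close> leaves at most one cluster
  of size \<open>1\<close>, so that no distance \<open>\<alpha>\<close> occurs.

  The equilateral number is a maximum, so the cardinalities of equilateral sets must also be bounded;
  this follows from the total boundedness of a ball (\<open>equilateral_card_bounded\<close>).
\<close>

section \<open>Isometric embeddings into spaces of small dimension\<close>

lemma isometric_embedding:
  fixes W :: "'a::euclidean_space set"
  assumes "dim W \<le> DIM('b::euclidean_space)"
  obtains f :: "'a \<Rightarrow> 'b::euclidean_space" where "\<And>v w. v \<in> span W \<Longrightarrow> w \<in> span W \<Longrightarrow> norm (f v - f w) = norm (v - w)"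
proof -
  have "dim (span W) \<le> dim (UNIV :: 'b set)"
    using assms by (simp add: dim_UNIV)
  then obtain f :: "'a \<Rightarrow> 'b" where f: "linear f" "\<And>x. x \<in> span W \<Longrightarrow> norm (f x) = norm x"
    by (metis isometry_subset_subspace subspace_UNIV subspace_span)
  show ?thesis
  proof
    fix v w assume "v \<in> span W" "w \<in> span W"
    then show "norm (f v - f w) = norm (v - w)"
      using f by (metis linear_diff span_diff)
  qed
qed

text \<open>Once one of the points is moved to the origin, the others alone span the configuration.\<close>

lemma few_points_embedding:
  fixes v :: "'c::finite \<Rightarrow> 'e::euclidean_space"
  assumes "CARD('c) \<le> DIM('b::euclidean_space) + 1"
  obtains X :: "'c \<Rightarrow> 'b::euclidean_space" where "\<And>c d. norm (X c - X d) = norm (v c - v d)"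
proof -
  fix c0 :: 'c
  let ?W = "(\<lambda>c. v c - v c0) ` (UNIV - {c0})"
  have "dim ?W \<le> card (UNIV - {c0})"
    by (rule order_trans[OF dim_le_card' card_image_le]) auto
  also have "\<dots> \<le> DIM('b)"
    using assms by simp
  finally obtain f :: "'e \<Rightarrow> 'b"
    where f: "\<And>v w. v \<in> span ?W \<Longrightarrow> w \<in> span ?W \<Longrightarrow> norm (f v - f w) = norm (v - w)"
    using isometric_embedding by blast
  have "v c - v c0 \<in> span ?W" for c
    by (cases "c = c0") (auto intro: span_base span_zero)
  then show ?thesis
    using f by (intro that[of "\<lambda>c. f (v c - v c0)"]) simp
qed

section \<open>Regular simplices centred at the origin\<close>

text \<open>For \<open>i \<in> A\<close> these are the vertices of a regular simplex of side \<open>sqrt 2\<close> with its centroid at the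
  origin. Using the coordinates as labels makes the simplices over disjoint sets orthogonal.\<close>

definition centred :: "'i set \<Rightarrow> 'i \<Rightarrow> real ^ 'i::finite" where
  "centred A i = axis i 1 - (1 / real (card A)) *\<^sub>R (\<Sum>j\<in>A. axis j 1)"

lemma inner_centred:
  assumes "i \<in> A" "j \<in> A"
  shows "centred A i \<bullet> centred A j = (if i = j then 1 else 0) - 1 / real (card A)"
proof -
  have c: "card A \<noteq> 0" using assms by auto
  show ?thesis using assms c
    by (simp add: centred_def inner_diff_left inner_diff_right inner_sum_left inner_sum_right
        inner_axis_axis inner_real_def sum_subtractf)
qed

lemma inner_centred_disjoint:
  assumes "i \<in> A" "j \<in> B" "A \<inter> B = {}"
  shows "centred A i \<bullet> centred B j = 0"
proof -
  have *: "x \<noteq> y" if "x \<in> A" "y \<in> B" for x y using assms that by auto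
  show ?thesis using assms(1,2) *
    by (auto simp: centred_def inner_diff_left inner_diff_right inner_sum_left inner_sum_right
        inner_axis_axis intro!: sum.neutral)
qed

lemma sum_centred: "(\<Sum>i\<in>A. centred A i) = 0"
  by (cases "A = {}") (simp_all add: centred_def sum_subtractf sum_constant_scaleR del: sum_constant)

lemma norm_centred_diff:
  assumes "i \<in> A" "j \<in> A" "i \<noteq> j"
  shows "norm (s *\<^sub>R centred A i - s *\<^sub>R centred A j) = \<bar>s\<bar> * sqrt 2"
proof -
  have "(norm (centred A i - centred A j))\<^sup>2 = 2"
    using assms by (simp add: power2_norm_eq_inner inner_diff_left inner_diff_right inner_centred)
  then have "norm (centred A i - centred A j) = sqrt 2"
    by (metis norm_ge_zero real_sqrt_unique)
  then show ?thesis
    by (simp flip: scaleR_diff_right)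
qed

lemma norm_centred_disjoint:
  assumes "i \<in> A" "j \<in> B" "A \<inter> B = {}"
  shows "(norm (s *\<^sub>R centred A i - t *\<^sub>R centred B j))\<^sup>2
    = s\<^sup>2 * (1 - 1 / card A) + t\<^sup>2 * (1 - 1 / card B)"
proof -
  have "B \<inter> A = {}" using assms by auto
  then show ?thesis
    using assms by (simp add: power2_norm_eq_inner inner_diff_left inner_diff_right inner_centred
      inner_centred_disjoint power2_eq_square[of s] power2_eq_square[of t])
qed

section \<open>The two components of the configuration\<close>

lemma clusters_exist:
  fixes m :: "'c::finite \<Rightarrow> nat"
  assumes "(\<Sum>c\<in>UNIV. m c) = CARD('i::finite)"
  obtains p :: "'i::finite \<Rightarrow> 'c" where "\<And>c. card (p -` {c}) = m c"
proof -
  let ?S = "SIGMA c:(UNIV :: 'c set). {..<m c}"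
  have "card ?S = CARD('i)"
    using assms by simp
  then obtain g where g: "bij_betw g (UNIV :: 'i set) ?S"
    using finite_same_card_bij[of "UNIV :: 'i set" ?S] by auto
  have "(fst \<circ> g) -` {c} = g -` ({c} \<times> UNIV)" for c
    by (auto simp: mem_Times_iff)
  then have "g ` ((fst \<circ> g) -` {c}) = ({c} \<times> UNIV) \<inter> range g" for c
    by (simp add: image_vimage_eq)
  then have "g ` ((fst \<circ> g) -` {c}) = {c} \<times> {..<m c}" for c
    using bij_betw_imp_surj_on[OF g] by auto
  then have "card ((fst \<circ> g) -` {c}) = m c" for c
    using card_image[OF inj_on_subset[OF bij_betw_imp_inj_on[OF g] subset_UNIV], of "(fst \<circ> g) -` {c}"]
    by (simp add: card_cartesian_product)
  then show ?thesis using that by blast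
qed

text \<open>The vectors of a cluster sum to zero, so one representative of each cluster is redundant in the
  span; this is what saves \<open>CARD('c)\<close> dimensions.\<close>

lemma orthogonal_clusters:
  fixes p :: "'i::finite \<Rightarrow> 'c::finite"
  assumes ne: "\<And>c. p -` {c} \<noteq> {}" and dim: "CARD('i) \<le> DIM('b::euclidean_space) + CARD('c)"
  obtains Y :: "'i \<Rightarrow> 'b::euclidean_space" where
    "\<And>i j. i \<noteq> j \<Longrightarrow> p i = p j \<Longrightarrow> norm (Y i - Y j) = 1"
    "\<And>i j. p i \<noteq> p j \<Longrightarrow> norm (Y i - Y j)
      = sqrt (((1 - 1 / card (p -` {p i})) + (1 - 1 / card (p -` {p j}))) / 2)"
proof -
  define w where "w i = (1 / sqrt 2) *\<^sub>R centred (p -` {p i}) i" for i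
  have "\<exists>i. p i = c" for c
    using ne[of c] by auto
  then obtain rep where rep: "\<And>c. p (rep c) = c"
    by metis
  let ?W = "w ` (UNIV - range rep)"
  have "inj rep" using rep by (rule inj_on_inverseI)
  then have "card (UNIV - range rep) = CARD('i) - CARD('c)"
    by (simp add: card_Diff_subset card_image)
  moreover have "dim ?W \<le> card (UNIV - range rep)"
    by (rule order_trans[OF dim_le_card' card_image_le]) auto
  ultimately have dim_W: "dim ?W \<le> DIM('b)"
    using dim by simp
  obtain f :: "real ^ 'i \<Rightarrow> 'b"
    where f: "\<And>v w. v \<in> span ?W \<Longrightarrow> w \<in> span ?W \<Longrightarrow> norm (f v - f w) = norm (v - w)"
    using dim_W by (rule isometric_embedding) blast
  have non: "w i \<in> span ?W" if "i \<notin> range rep" for i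
    using that by (intro span_base) auto
  have reps: "w (rep c) \<in> span ?W" for c
  proof -
    have "(\<Sum>i\<in>p -` {c}. w i) = (1 / sqrt 2) *\<^sub>R (\<Sum>i\<in>p -` {c}. centred (p -` {c}) i)"
      by (simp add: w_def scaleR_right.sum)
    then have "0 = (\<Sum>i\<in>p -` {c}. w i)"
      by (simp add: sum_centred)
    also have "\<dots> = w (rep c) + (\<Sum>i\<in>p -` {c} - {rep c}. w i)"
      using rep by (simp add: sum.remove)
    finally have eq: "w (rep c) = - (\<Sum>i\<in>p -` {c} - {rep c}. w i)"
      by (simp add: eq_neg_iff_add_eq_0)
    have "i \<notin> range rep" if "i \<in> p -` {c} - {rep c}" for i
      using that rep by auto
    then show ?thesis
      unfolding eq by (intro span_neg span_sum non)
  qed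
  have span: "w i \<in> span ?W" for i
    using non reps by (cases "i \<in> range rep") auto
  show ?thesis
  proof (rule that[of "\<lambda>i. f (w i)"])
    fix i j assume "i \<noteq> j" "p i = p j"
    then have "norm (w i - w j) = 1"
      by (simp add: w_def norm_centred_diff)
    then show "norm (f (w i) - f (w j)) = 1"
      by (simp only: f span)
  next
    fix i j assume "p i \<noteq> p j"
    then have *: "(norm (w i - w j))\<^sup>2
        = ((1 - 1 / card (p -` {p i})) + (1 - 1 / card (p -` {p j}))) / 2"
      unfolding w_def by (subst norm_centred_disjoint) (auto simp: power_divide add_divide_distrib diff_divide_distrib)
    show "norm (f (w i) - f (w j))
      = sqrt (((1 - 1 / card (p -` {p i})) + (1 - 1 / card (p -` {p j}))) / 2)"
      using real_sqrt_unique[OF * norm_ge_zero] by (simp only: f span)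
  qed
qed

text \<open>The left-hand side of \<open>gap\<close> is the sum of the squared circumradii, that is, the squared
  distance between vertices of the two simplices when both are centred at the origin. The rest of
  \<open>\<gamma>\<^sup>2\<close> is supplied by a translation in an extra coordinate; counting points rather than coordinates
  shows that this coordinate does not increase the dimension needed.\<close>

lemma two_simplices:
  fixes P :: "'c::finite set"
  assumes dim: "CARD('c) \<le> DIM('a::euclidean_space) + 1"
    and nonneg: "0 \<le> \<alpha>" "0 \<le> \<beta>" "0 \<le> \<gamma>"
    and gap: "P \<noteq> {} \<Longrightarrow> - P \<noteq> {} \<Longrightarrow>
      \<alpha>\<^sup>2 / 2 * (1 - 1 / card (- P)) + \<beta>\<^sup>2 / 2 * (1 - 1 / card P) \<le> \<gamma>\<^sup>2"
  obtains X :: "'c \<Rightarrow> 'a::euclidean_space" where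
    "\<And>c d. c \<noteq> d \<Longrightarrow> norm (X c - X d) =
      (if c \<in> P \<and> d \<in> P then \<beta> else if c \<in> P \<or> d \<in> P then \<gamma> else \<alpha>)"
proof -
  define h where
    "h = sqrt (\<gamma>\<^sup>2 - (\<alpha>\<^sup>2 / 2 * (1 - 1 / card (- P)) + \<beta>\<^sup>2 / 2 * (1 - 1 / card P)))"
  define v :: "'c \<Rightarrow> (real ^ 'c) \<times> real" where
    "v c = (if c \<in> P then ((\<beta> / sqrt 2) *\<^sub>R centred P c, h)
      else ((\<alpha> / sqrt 2) *\<^sub>R centred (- P) c, 0))" for c
  obtain X :: "'c \<Rightarrow> 'a" where X: "\<And>c d. norm (X c - X d) = norm (v c - v d)"
    using dim by (rule few_points_embedding[where v = v]) blast
  have outside: "norm (v c - v d) = \<alpha>" if "c \<noteq> d" "c \<notin> P" "d \<notin> P" for c d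
    using that nonneg by (simp add: v_def norm_Pair norm_centred_diff)
  have inside: "norm (v c - v d) = \<beta>" if "c \<noteq> d" "c \<in> P" "d \<in> P" for c d
    using that nonneg by (simp add: v_def norm_Pair norm_centred_diff)
  have across: "norm (v c - v d) = \<gamma>" if cd: "c \<notin> P" "d \<in> P" for c d
  proof -
    have "h\<^sup>2 = \<gamma>\<^sup>2 - (\<alpha>\<^sup>2 / 2 * (1 - 1 / card (- P)) + \<beta>\<^sup>2 / 2 * (1 - 1 / card P))"
      unfolding h_def using gap cd by (subst real_sqrt_pow2) auto
    moreover have "(norm (v c - v d))\<^sup>2
        = (norm ((\<alpha> / sqrt 2) *\<^sub>R centred (- P) c - (\<beta> / sqrt 2) *\<^sub>R centred P d))\<^sup>2 + h\<^sup>2"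
      using cd by (simp add: v_def norm_Pair)
    ultimately have "(norm (v c - v d))\<^sup>2 = \<gamma>\<^sup>2"
      using cd by (simp add: norm_centred_disjoint power_divide)
    then show ?thesis
      using power2_eq_imp_eq[of "norm (v c - v d)" \<gamma>] nonneg by simp
  qed
  have across': "norm (v c - v d) = \<gamma>" if "c \<in> P" "d \<notin> P" for c d
    using across[OF that(2,1)] by (simp add: norm_minus_commute)
  show ?thesis
    by (rule that[of X]) (auto simp: X outside inside across across')
qed

section \<open>The numerical condition\<close>

lemma cauchy_two:
  fixes x y k l :: real
  assumes "k > 0" "l > 0"
  shows "(x + y)\<^sup>2 / (k + l) \<le> x\<^sup>2 / k + y\<^sup>2 / l"
proof -
  have "(x\<^sup>2 * l + y\<^sup>2 * k) * (k + l) - (x + y)\<^sup>2 * (k * l) = (l * x - k * y)\<^sup>2"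
    by (simp add: algebra_simps power2_eq_square)
  then have "(x + y)\<^sup>2 * (k * l) \<le> (x\<^sup>2 * l + y\<^sup>2 * k) * (k + l)"
    by (metis diff_ge_0_iff_ge zero_le_power2)
  then have "(x + y)\<^sup>2 / (k + l) \<le> (x\<^sup>2 * l + y\<^sup>2 * k) / (k * l)"
    using assms by (simp add: pos_divide_le_eq pos_le_divide_eq)
  also have "\<dots> = x\<^sup>2 / k + y\<^sup>2 / l"
    using assms by (simp add: add_frac_eq)
  finally show ?thesis .
qed

text \<open>Since \<open>q\<^sup>2 - p\<^sup>2 = w\<close> with \<open>w = 1 / (n * (n + 1))\<close>, both sides are of order \<open>w\<^sup>2\<close> up to
  a factor that on the right grows like \<open>n\<^sup>2\<close>. Hence crude estimates suffice from \<open>n = 3\<close> on. For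
  \<open>n = 2\<close> the two sides differ by about three per cent, and \<open>28\<close> is the largest integer for which the
  inequality holds.\<close>

lemma root_gap_bound:
  fixes n :: nat
  assumes "n \<ge> 2"
  defines "p \<equiv> sqrt (1 - 1 / n)" and "q \<equiv> sqrt (1 - 1 / Suc n)"
  shows "28 * (q - p)\<^sup>2 \<le> (p + q) * (2 - p - q)\<^sup>2"
proof (cases "n = 2")
  case True
  have "7071 / 10000 \<le> p" "p \<le> 7072 / 10000" "8164 / 10000 \<le> q" "q \<le> 8165 / 10000"
    unfolding p_def q_def True
    by (intro real_le_rsqrt real_le_lsqrt; simp add: power2_eq_square)+
  then have "\<bar>q - p\<bar> \<le> 1094 / 10000" "4763 / 10000 \<le> 2 - p - q" "15235 / 10000 \<le> p + q"
    by auto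
  then have "(q - p)\<^sup>2 \<le> (1094 / 10000)\<^sup>2" "(4763 / 10000)\<^sup>2 \<le> (2 - p - q)\<^sup>2"
    by (auto intro: power_mono simp: abs_le_square_iff[symmetric])
  then have "15235 / 10000 * (4763 / 10000)\<^sup>2 \<le> (p + q) * (2 - p - q)\<^sup>2"
    using \<open>15235 / 10000 \<le> p + q\<close> by (intro mult_mono) auto
  then show ?thesis
    using \<open>(q - p)\<^sup>2 \<le> _\<close> by (simp add: power2_eq_square)
next
  case False
  then have n: "real n \<ge> 3" using assms by simp
  define w where "w = 1 / (real n * real (Suc n))"
  have "w > 0" using n by (simp add: w_def)
  have pp: "p\<^sup>2 = 1 - 1 / n" and qq: "q\<^sup>2 = 1 - 1 / Suc n"
    using n by (simp_all add: p_def q_def)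
  have "(8 / 10 :: real) \<le> p" "(8 / 10 :: real) \<le> q"
    unfolding p_def q_def
    by (intro real_le_rsqrt; use n in \<open>simp add: field_simps power2_eq_square\<close>)+
  then have s: "p + q \<ge> 8 / 5" by simp
  have "(q - p) * (p + q) = q\<^sup>2 - p\<^sup>2" by (simp add: algebra_simps power2_eq_square)
  also have "\<dots> = w" using n by (simp add: pp qq w_def field_simps)
  finally have d: "(q - p) * (p + q) = w" .
  then have "0 < (q - p) * (p + q)" using \<open>w > 0\<close> by simp
  then have "0 \<le> q - p" using s
    by (simp add: zero_less_mult_iff)
  moreover from this have "(q - p) * (8 / 5) \<le> (q - p) * (p + q)"
    using s by (intro mult_left_mono)
  ultimately have dw: "0 \<le> q - p" "q - p \<le> 5 / 8 * w" using d by auto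
  have "2 * (1 - p) \<ge> 1 / n" "2 * (1 - q) \<ge> 1 / Suc n"
    using pp qq sum_squares_bound[of p 1] sum_squares_bound[of q 1] by auto
  then have "2 - p - q \<ge> (1 / n + 1 / Suc n) / 2" by argo
  moreover have "(1 / n + 1 / Suc n) / 2 \<ge> 7 / 2 * w"
    using n by (simp add: w_def divide_simps)
  ultimately have "2 - p - q \<ge> 7 / 2 * w" by linarith
  then have "(7 / 2 * w)\<^sup>2 \<le> (2 - p - q)\<^sup>2"
    using \<open>w > 0\<close> by (intro power_mono) auto
  then have "8 / 5 * (7 / 2 * w)\<^sup>2 \<le> (p + q) * (2 - p - q)\<^sup>2"
    using s by (intro mult_mono) auto
  moreover have "(q - p)\<^sup>2 \<le> (5 / 8 * w)\<^sup>2"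
    using dw by (intro power_mono)
  moreover have "28 * (5 / 8 * w)\<^sup>2 \<le> 8 / 5 * (7 / 2 * w)\<^sup>2"
    by (simp add: power2_eq_square)
  ultimately show ?thesis by linarith
qed

text \<open>The condition says \<open>4 * r - 2 * (p + q) \<le> (1 - p)\<^sup>2 / k + (1 - q)\<^sup>2 / l\<close>. On the left the excess
  of the quadratic over the arithmetic mean is at most \<open>(q - p)\<^sup>2 / (4 * (p + q))\<close>; on the right the
  Cauchy-Schwarz inequality removes the dependence on how \<open>k + l\<close> is split.\<close>

lemma simplices_fit:
  fixes n k l :: nat
  assumes "n \<ge> 1" "k \<ge> 1" "l \<ge> 1" "k + l \<le> 28" and one: "n = 1 \<Longrightarrow> k = 1"
  defines "p \<equiv> sqrt (1 - 1 / n)" and "q \<equiv> sqrt (1 - 1 / Suc n)"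
    and "r \<equiv> sqrt (((1 - 1 / n) + (1 - 1 / Suc n)) / 2)"
  shows "(1 - p)\<^sup>2 / 2 * (1 - 1 / k) + (1 - q)\<^sup>2 / 2 * (1 - 1 / l) \<le> (1 - r)\<^sup>2"
proof (cases "n = 1")
  case True
  have "r = 1 / 2" by (simp add: r_def True real_sqrt_divide)
  have "1 / 2 \<le> q" "q \<le> 1"
    unfolding q_def True
    by (intro real_le_rsqrt real_le_lsqrt; simp add: power2_eq_square)+
  then have "(1 - q)\<^sup>2 \<le> (1 / 2)\<^sup>2" by (intro power_mono) auto
  moreover have "(1 - q)\<^sup>2 * (1 - 1 / l) \<le> (1 - q)\<^sup>2"
    by (intro mult_left_le) auto
  ultimately show ?thesis
    using one[OF True] by (simp add: \<open>r = 1 / 2\<close> power2_eq_square)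
next
  case False
  then have n: "n \<ge> 2" using assms by simp
  have pq: "p > 0" "q > 0" "p \<le> 1" "q \<le> 1"
    using n by (auto simp: p_def q_def)
  have "p\<^sup>2 = 1 - 1 / n" "q\<^sup>2 = 1 - 1 / Suc n"
    using n by (simp_all add: p_def q_def)
  then have r1: "r = sqrt ((p\<^sup>2 + q\<^sup>2) / 2)"
    by (simp add: r_def)
  then have r2: "r\<^sup>2 = (p\<^sup>2 + q\<^sup>2) / 2"
    by simp
  define e where "e = (q - p)\<^sup>2 / (p + q)"
  have "r \<le> (p + q) / 2 + e / 4"
    unfolding r1
  proof (rule real_le_lsqrt)
    have "((p + q) / 2 + e / 4)\<^sup>2 = (p\<^sup>2 + q\<^sup>2) / 2 + (e / 4)\<^sup>2 + (e * (p + q) - (q - p)\<^sup>2) / 4"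
      by (simp add: power2_eq_square field_simps)
    moreover have "e * (p + q) = (q - p)\<^sup>2" using pq by (simp add: e_def)
    ultimately show "(p\<^sup>2 + q\<^sup>2) / 2 \<le> ((p + q) / 2 + e / 4)\<^sup>2" by simp
  qed (use pq in \<open>auto simp: e_def\<close>)
  moreover have "e \<le> (2 - p - q)\<^sup>2 / 28"
    using root_gap_bound[OF n] pq unfolding e_def p_def q_def
    by (simp add: divide_simps mult.commute add_pos_pos)
  ultimately have "4 * r - 2 * (p + q) \<le> (2 - p - q)\<^sup>2 / 28" by linarith
  also have "\<dots> \<le> (2 - p - q)\<^sup>2 / (real k + real l)"
    using assms(3,4) by (intro divide_left_mono) auto
  also have "\<dots> = ((1 - p) + (1 - q))\<^sup>2 / (real k + real l)"
    by (simp add: algebra_simps)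
  also have "\<dots> \<le> (1 - p)\<^sup>2 / k + (1 - q)\<^sup>2 / l"
    using assms(2,3) by (intro cauchy_two) auto
  finally have "4 * r - 2 * (p + q) \<le> (1 - p)\<^sup>2 / k + (1 - q)\<^sup>2 / l" .
  moreover have "(1 - p)\<^sup>2 + (1 - q)\<^sup>2 - 2 * (1 - r)\<^sup>2 = 4 * r - 2 * (p + q)"
    by (simp add: power2_diff r2 field_simps)
  moreover have "(x - x') / 2 + (y - y') / 2 \<le> z"
    if "u \<le> x' + y'" "x + y - 2 * z = u" for x x' y y' z u :: real
    using that by argo
  ultimately have "((1 - p)\<^sup>2 - (1 - p)\<^sup>2 / k) / 2 + ((1 - q)\<^sup>2 - (1 - q)\<^sup>2 / l) / 2 \<le> (1 - r)\<^sup>2"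
    by blast
  then show ?thesis by (simp add: right_diff_distrib diff_divide_distrib)
qed

section \<open>The equilateral set\<close>

text \<open>There is one cluster for each element of \<open>'a option\<close>, a type with exactly one element more than
  the dimension of the first summand; \<open>P\<close> is the set of the clusters that have \<open>n + 1\<close> elements.\<close>

lemma short_side_configuration:
  assumes card: "CARD('i::finite) = CARD('a::finite) + CARD('b::finite) + 1"
    and le: "CARD('a) \<le> CARD('b)" "CARD('a) \<le> 27"
  shows "\<exists>(X :: 'i \<Rightarrow> real ^ 'a) (Y :: 'i \<Rightarrow> real ^ 'b).
    \<forall>i j. i \<noteq> j \<longrightarrow> norm (X i - X j) + norm (Y i - Y j) = 1"
proof -
  define K where "K = CARD('a option)"
  define n where "n = CARD('i) div K"
  define t where "t = CARD('i) mod K"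
  have K: "K = CARD('a) + 1" by (simp add: K_def)
  have "K \<le> CARD('i)" using card K by simp
  then have n1: "n \<ge> 1" using K by (simp add: n_def div_greater_zero_iff Suc_le_eq)
  have "t < K" using K by (simp add: t_def)
  have N: "CARD('i) = n * K + t" by (simp add: n_def t_def)
  obtain P :: "'a option set" where P: "card P = t"
    using \<open>t < K\<close> obtain_subset_with_card_n[of t "UNIV :: 'a option set"] by (auto simp: K_def)
  have mP: "card (- P) = K - t" by (simp add: Compl_eq_Diff_UNIV card_Diff_subset P K_def)
  define m where "m c = (if c \<in> P then Suc n else n)" for c
  have "(\<Sum>c\<in>UNIV. m c) = (\<Sum>c\<in>UNIV. n + (if c \<in> P then 1 else 0))"
    by (intro sum.cong) (auto simp: m_def)
  also have "\<dots> = CARD('i)"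
    by (simp add: sum.distrib N P K_def flip: sum.inter_filter)
  finally obtain p :: "'i \<Rightarrow> 'a option" where p: "\<And>c. card (p -` {c}) = m c"
    using clusters_exist by blast
  have "p -` {c} \<noteq> {}" for c
    using p[of c] n1 by (auto simp: m_def split: if_splits)
  moreover have "CARD('i) \<le> DIM(real ^ 'b) + CARD('a option)"
    using card by simp
  ultimately obtain Y :: "'i \<Rightarrow> real ^ 'b" where Y:
      "\<And>i j. i \<noteq> j \<Longrightarrow> p i = p j \<Longrightarrow> norm (Y i - Y j) = 1"
      "\<And>i j. p i \<noteq> p j \<Longrightarrow> norm (Y i - Y j)
        = sqrt (((1 - 1 / card (p -` {p i})) + (1 - 1 / card (p -` {p j}))) / 2)"
    by (rule orthogonal_clusters) blast
  define \<alpha> where "\<alpha> = 1 - sqrt (1 - 1 / n)"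
  define \<beta> where "\<beta> = 1 - sqrt (1 - 1 / Suc n)"
  define \<gamma> where "\<gamma> = 1 - sqrt (((1 - 1 / n) + (1 - 1 / Suc n)) / 2)"
  have "0 \<le> 1 / real n" "0 \<le> 1 / real (Suc n)" by simp_all
  then have "((1 - 1 / n) + (1 - 1 / Suc n)) / 2 \<le> 1" by argo
  then have \<gamma>: "0 \<le> \<gamma>" unfolding \<gamma>_def by (simp only: real_sqrt_le_1_iff diff_ge_0_iff_ge)
  have \<alpha>\<beta>: "0 \<le> \<alpha>" "0 \<le> \<beta>"
    by (simp_all add: \<alpha>_def \<beta>_def)
  have gap: "\<alpha>\<^sup>2 / 2 * (1 - 1 / card (- P)) + \<beta>\<^sup>2 / 2 * (1 - 1 / card P) \<le> \<gamma>\<^sup>2"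
    if "P \<noteq> {}" "- P \<noteq> {}"
  proof -
    have "t \<ge> 1" using that P by (simp add: Suc_le_eq card_gt_0_iff flip: P)
    \<comment> \<open>\<open>a \<le> b\<close> gives \<open>2 * K - 1 \<le> K + t\<close>: at most one cluster is a single point.\<close>
    have "K - t = 1" if "n = 1"
      using that N card K le(1) \<open>t < K\<close> by simp
    then show ?thesis
      unfolding \<alpha>_def \<beta>_def \<gamma>_def mP P
      using n1 \<open>t \<ge> 1\<close> \<open>t < K\<close> K le(2) by (intro simplices_fit) auto
  qed
  have dim: "CARD('a option) \<le> DIM(real ^ 'a) + 1" by simp
  obtain X :: "'a option \<Rightarrow> real ^ 'a" where X:
      "\<And>c d. c \<noteq> d \<Longrightarrow> norm (X c - X d) =
        (if c \<in> P \<and> d \<in> P then \<beta> else if c \<in> P \<or> d \<in> P then \<gamma> else \<alpha>)"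
    by (rule two_simplices[OF dim \<alpha>\<beta> \<gamma> gap]; blast)
  have "norm (X (p i) - X (p j)) + norm (Y i - Y j) = 1" if "i \<noteq> j" for i j
  proof (cases "p i = p j")
    case True
    then show ?thesis using Y(1)[OF that] by simp
  next
    case False
    have "norm (X (p i) - X (p j))
        = 1 - sqrt (((1 - 1 / m (p i)) + (1 - 1 / m (p j))) / 2)"
      unfolding X[OF False] by (simp add: \<alpha>_def \<beta>_def \<gamma>_def m_def add.commute)
    then show ?thesis using Y(2)[OF False] by (simp add: p)
  qed
  then show ?thesis
    by (intro exI[of _ "\<lambda>i. X (p i)"] exI[of _ Y]) auto
qed

lemma l1_unit_configuration:
  assumes card: "CARD('i::finite) = CARD('a::finite) + CARD('b::finite) + 1"
    and le: "CARD('a) \<le> 27"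
  shows "\<exists>(X :: 'i \<Rightarrow> real ^ 'a) (Y :: 'i \<Rightarrow> real ^ 'b).
    \<forall>i j. i \<noteq> j \<longrightarrow> norm (X i - X j) + norm (Y i - Y j) = 1"
proof (cases "CARD('a) \<le> CARD('b)")
  case True
  then show ?thesis using card le by (intro short_side_configuration)
next
  case False
  then have "\<exists>(Y :: 'i \<Rightarrow> real ^ 'b) (X :: 'i \<Rightarrow> real ^ 'a).
      \<forall>i j. i \<noteq> j \<longrightarrow> norm (Y i - Y j) + norm (X i - X j) = 1"
    using card le by (intro short_side_configuration) auto
  then show ?thesis by (subst ex_comm) (simp add: add.commute)
qed

section \<open>Equilateral sets have bounded cardinality\<close>

text \<open>The product type carries the Euclidean combination of the two norms, which lies between half of the
  \<open>\<ell>\<^sub>1\<close> norm and the \<open>\<ell>\<^sub>1\<close> norm. An equilateral set, rescaled to side \<open>1\<close>, therefore becomes a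
  subset of the unit ball of a Euclidean space with mutual distances at least \<open>1 / 2\<close>, and a ball of
  radius \<open>1 / 4\<close> contains at most one of its points.\<close>

lemma equilateral_card_bounded:
  "\<exists>M. \<forall>S :: ('a::euclidean_space \<oplus>\<^sub>1 'b::euclidean_space) set. equilateral S \<longrightarrow> card S \<le> M"
proof -
  have "compact (cball (0 :: 'a \<times> 'b) 1)" by simp
  then obtain T where T: "finite T" "cball (0 :: 'a \<times> 'b) 1 \<subseteq> (\<Union>x\<in>T. ball x (1 / 4))"
    unfolding compact_eq_totally_bounded by (meson zero_less_divide_1_iff zero_less_numeral)
  have "card S \<le> card T" if "equilateral S" for S :: "('a \<oplus>\<^sub>1 'b) set"
  proof (cases "S = {}")
    case False
    then obtain z0 where z0: "z0 \<in> S" by auto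
    obtain l where l: "l > 0" "\<And>x y. x \<in> S \<Longrightarrow> y \<in> S \<Longrightarrow> x \<noteq> y \<Longrightarrow> norm (x - y) = l"
      using \<open>equilateral S\<close> unfolding equilateral_def by blast
    define g :: "('a \<oplus>\<^sub>1 'b) \<Rightarrow> 'a \<times> 'b" where
      "g z = (1 / l) *\<^sub>R (l1_fst z - l1_fst z0, l1_snd z - l1_snd z0)" for z
    have le: "norm (g z) \<le> norm (z - z0) / l" for z
      using l(1) norm_Pair_le[of "l1_fst z - l1_fst z0" "l1_snd z - l1_snd z0"]
      by (simp add: g_def norm_l1_sum_def minus_l1_sum_def divide_right_mono del: scaleR_Pair)
    have ge: "norm (z - w) / (2 * l) \<le> dist (g z) (g w)" for z w
    proof -
      have "g z - g w = (1 / l) *\<^sub>R (l1_fst z - l1_fst w, l1_snd z - l1_snd w)"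
        by (simp add: g_def flip: scaleR_diff_right)
      then have "dist (g z) (g w) = norm (l1_fst z - l1_fst w, l1_snd z - l1_snd w) / l"
        using l(1) by (simp add: dist_norm del: scaleR_Pair)
      moreover have "norm (z - w) \<le> 2 * norm (l1_fst z - l1_fst w, l1_snd z - l1_snd w)"
        using norm_fst_le[of "l1_fst z - l1_fst w" "l1_snd z - l1_snd w"]
          norm_snd_le[of "l1_snd z - l1_snd w" "l1_fst z - l1_fst w"]
        by (simp add: norm_l1_sum_def minus_l1_sum_def)
      ultimately show ?thesis using l(1) by (simp add: field_simps)
    qed
    have "norm (z - z0) \<le> l" if "z \<in> S" for z
      using l that z0 by (cases "z = z0") auto
    then have "g z \<in> cball 0 1" if "z \<in> S" for z
      using le[of z] that l(1) by (smt (verit) divide_le_eq_1_pos mem_cball_0)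
    then have "\<forall>z\<in>S. \<exists>x\<in>T. g z \<in> ball x (1 / 4)"
      using T(2) by blast
    then obtain h where h: "\<And>z. z \<in> S \<Longrightarrow> h z \<in> T \<and> dist (h z) (g z) < 1 / 4"
      by (metis mem_ball)
    have "inj_on h S"
    proof (rule inj_onI, rule ccontr)
      fix z w assume zw: "z \<in> S" "w \<in> S" "h z = h w" "z \<noteq> w"
      then have "dist (g z) (g w) < 1 / 2"
        using h[of z] h[of w] dist_triangle2[of "g z" "g w" "h z"] by (simp add: dist_commute)
      moreover have "1 / 2 \<le> dist (g z) (g w)"
        using ge[of z w] l zw by simp
      ultimately show False by simp
    qed
    then show ?thesis
      using T(1) h by (intro card_inj_on_le[of h]) auto
  qed simp
  then show ?thesis by blast
qed

section \<open>The lower bound\<close>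

theorem mainTheorem1:
  assumes "CARD('a::finite) \<le> 27"
  shows "equilateral_number TYPE((real ^ 'a) \<oplus>\<^sub>1 (real ^ 'b::finite)) \<ge> CARD('a) + CARD('b) + 1 \<and>
    (\<exists>S :: ((real ^ 'a) \<oplus>\<^sub>1 (real ^ 'b)) set.
      finite S \<and> equilateral S \<and> card S = CARD('a) + CARD('b) + 1)"
proof
  have card: "CARD(('a + 'b) option) = CARD('a) + CARD('b) + 1"
    by simp
  obtain X :: "('a + 'b) option \<Rightarrow> real ^ 'a" and Y :: "('a + 'b) option \<Rightarrow> real ^ 'b"
    where XY: "\<And>i j. i \<noteq> j \<Longrightarrow> norm (X i - X j) + norm (Y i - Y j) = 1"
    using l1_unit_configuration[OF card assms] by blast
  define z where "z i = L1 (X i) (Y i)" for i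
  have z: "norm (z i - z j) = 1" if "i \<noteq> j" for i j
    using XY[OF that] by (simp add: z_def norm_l1_sum_def minus_l1_sum_def)
  have "inj z"
  proof (rule injI, rule ccontr)
    fix i j assume "z i = z j" "i \<noteq> j"
    then show False using z[OF \<open>i \<noteq> j\<close>] by simp
  qed
  then have "card (range z) = CARD('a) + CARD('b) + 1"
    using card by (simp add: card_image)
  moreover have "equilateral (range z)"
    unfolding equilateral_def
  proof (intro exI conjI ballI impI)
    fix x y assume "x \<in> range z" "y \<in> range z" "x \<noteq> y"
    then obtain i j where "x = z i" "y = z j" "i \<noteq> j" by blast
    then show "norm (x - y) = 1" using z[OF \<open>i \<noteq> j\<close>] by simp
  qed simp
  ultimately show ex: "\<exists>S :: ((real ^ 'a) \<oplus>\<^sub>1 (real ^ 'b)) set.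
      finite S \<and> equilateral S \<and> card S = CARD('a) + CARD('b) + 1"
    by (intro exI[of _ "range z"]) auto
  obtain M where "\<And>S :: ((real ^ 'a) \<oplus>\<^sub>1 (real ^ 'b)) set. equilateral S \<Longrightarrow> card S \<le> M"
    using equilateral_card_bounded by blast
  then have "finite {card S | S :: ((real ^ 'a) \<oplus>\<^sub>1 (real ^ 'b)) set. finite S \<and> equilateral S}"
    by (auto simp: finite_nat_set_iff_bounded_le)
  moreover have "CARD('a) + CARD('b) + 1
      \<in> {card S | S :: ((real ^ 'a) \<oplus>\<^sub>1 (real ^ 'b)) set. finite S \<and> equilateral S}"
    unfolding mem_Collect_eq using ex by metis
  ultimately show "equilateral_number TYPE((real ^ 'a) \<oplus>\<^sub>1 (real ^ 'b)) \<ge> CARD('a) + CARD('b) + 1"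
    unfolding equilateral_number_def by (rule Max_ge)
qed

end
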